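(* Let $\alpha>0$ be a non-integer real number, let $\nu>0$ be a non-integer real number, and let $x>a$. Then $$\begin{aligned}{}_aI_x^{\alpha}\,x^{\nu}K_{\nu}(x)=\frac{\pi}{2\sin(\pi\nu)}\Biggl(&\frac{2^{\nu}x^{\alpha}}{\Gamma(1-\nu)\Gamma(1+\alpha)}\,F_{23}\left(\frac12,1;1-\nu,\frac{\alpha+1}{2},\frac{\alpha+2}{2};\frac{x^2}{4}\right)\\&-\frac{2^{\nu}\,\Gamma(\nu+\frac12)}{\sqrt{\pi}\,\Gamma(\alpha+2\nu+1)}\,x^{\alpha+2\nu}\,F_{12}\left(\nu+\frac12;\frac{\alpha+2\nu+1}{2},\frac{\alpha}{2}+\nu+1;\frac{x^2}{4}\right)\\&-\frac{a\,2^{\nu}x^{\alpha-1}}{\Gamma(\alpha)}\sum_{k=0}^{\infty}\frac{a^{2k}\,F_{21}\left(2k+1,1-\alpha;2k+2;\frac{a}{x}\right)}{(2k+1)\,\Gamma(-\nu+k+1)\,4^k\,k!}\\&+\frac{a^{2\nu+1}}{2^{\nu}\,\Gamma(\alpha)}\,x^{\alpha-1}\sum_{k=0}^{\infty}\frac{a^{2k}\,F_{21}\left(2\nu+2k+1,1-\alpha;2\nu+2k+2;\frac{a}{x}\right)}{4^k\,k!\,(2\nu+2k+1)\,\Gamma(\nu+k+1)}\Biggr).\end{aligned}$$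
   Context: For a non-integer $\alpha>0$, a function $f$ and $x>a$, the left-sided Riemann-Liouville fractional integral of order $\alpha$ is ${}_aI_x^{\alpha}f(x)=\frac{1}{\Gamma(\alpha)}\int_a^x(x-\tau)^{\alpha-1}f(\tau)\,d\tau$. The notation ${}_aI_x^{\alpha}\,x^{\nu}K_{\nu}(x)$ means the operator applied to the function $\tau\mapsto\tau^{\nu}K_{\nu}(\tau)$, evaluated at $x$. $K_\nu$ is the modified Bessel function of the second kind and $\Gamma$ is the Gamma function. $F_{pq}(a_1,\ldots,a_p;b_1,\ldots,b_q;z)$ denotes the generalized hypergeometric function (hypergeometric series) ${}_pF_q$, with series $\sum_{k=0}^{\infty}\frac{(a_1)_k\cdots(a_p)_k}{(b_1)_k\cdots(b_q)_k}\frac{z^k}{k!}$, where $(c)_k=c(c+1)\cdots(c+k-1)$ is the Pochhammer symbol.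
   Formalization: The formal theorem assumes a ≥ 0 in addition to x > a, since for negative a the real powers τ^ν, a^{2ν+1} and K_ν(τ) on its branch cut are not defined as real quantities (and a/x is undefined at x = 0). *)

theory Defs
  imports "HOL-Analysis.Analysis"
begin

(* fps_hypergeo already contains the factor 1/k!, so this is the usual series of pFq. *)
definition hypergeo_F :: "real list \<Rightarrow> real list \<Rightarrow> real \<Rightarrow> real" where
  "hypergeo_F as bs z = eval_fps (fps_hypergeo as bs 1) z"

lemma hypergeo_F_altdef:
  "hypergeo_F as bs z =
     (\<Sum>k. (\<Prod>a\<leftarrow>as. pochhammer a k) / (\<Prod>b\<leftarrow>bs. pochhammer b k) * z ^ k / fact k)"
proof -
  have eq: "foldl (\<lambda>r c. r * pochhammer c k) r cs = r * (\<Prod>c\<leftarrow>cs. pochhammer c k)"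
    for r :: real and cs k
    by (induction cs arbitrary: r) (simp_all add: mult.assoc)
  show ?thesis
    by (simp add: hypergeo_F_def eval_fps_def eq)
qed

(* Real Bessel functions, meaningful for x > 0. With the entire function rGamma = 1/Gamma,
   the terms of negative integer order with k + nu + 1 a pole of Gamma vanish, as they should. *)
definition Bessel_I :: "real \<Rightarrow> real \<Rightarrow> real" where
  "Bessel_I \<nu> x = (x / 2) powr \<nu> * (\<Sum>k. rGamma (of_nat k + \<nu> + 1) * (x\<^sup>2 / 4) ^ k / fact k)"

(* At integer order the defining quotient is 0/0 and K is its limit in the order. *)
definition Bessel_K :: "real \<Rightarrow> real \<Rightarrow> real" where
  "Bessel_K \<nu> x =
     (let Q = (\<lambda>\<mu>. pi / 2 * (Bessel_I (-\<mu>) x - Bessel_I \<mu> x) / sin (pi * \<mu>))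
      in if \<nu> \<in> \<int> then Lim (at \<nu>) Q else Q \<nu>)"

definition RL_integrable :: "real \<Rightarrow> real \<Rightarrow> (real \<Rightarrow> real) \<Rightarrow> real \<Rightarrow> bool" where
  "RL_integrable a \<alpha> f x \<longleftrightarrow>
     set_integrable lborel {a..x} (\<lambda>\<tau>. (x - \<tau>) powr (\<alpha> - 1) * f \<tau>)"

definition RL_integral :: "real \<Rightarrow> real \<Rightarrow> (real \<Rightarrow> real) \<Rightarrow> real \<Rightarrow> real" where
  "RL_integral a \<alpha> f x =
     1 / Gamma \<alpha> * (LINT \<tau>:{a..x}|lborel. (x - \<tau>) powr (\<alpha> - 1) * f \<tau>)"

end

theory Submission
  imports Defs
begin

text \<open>
For non-integer order, \<open>K\<^sub>\<nu>\<close> is a combination of \<open>I\<^sub>-\<^sub>\<nu>\<close> and \<open>I\<^sub>\<nu>\<close>, and each of these is a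
power of its argument times a power series that converges everywhere. Hence
\<open>\<tau>\<^sup>\<nu> K\<^sub>\<nu>(\<tau>)\<close> is a combination of two series in the powers \<open>\<tau>\<^sup>2\<^sup>k\<close> and
\<open>\<tau>\<^sup>2\<^sup>k\<^sup>+\<^sup>2\<^sup>\<nu>\<close>, and the fractional integral is computed term by term. The two series
differ only in the parameters \<open>(p, \<mu>)\<close> of the exponents \<open>2k + p - 1\<close> and of the
coefficients \<open>1 / (\<Gamma>(k + \<mu> + 1) 4\<^sup>k k!)\<close>, which are \<open>(1, -\<nu>)\<close> and \<open>(2\<nu> + 1, \<nu>)\<close>,
so that everything except the last step is done once for general \<open>p\<close> and \<open>\<mu>\<close>.

The interval from \<open>a\<close> to \<open>x\<close> is the difference of the ones from \<open>0\<close> to \<open>x\<close> and from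
\<open>0\<close> to \<open>a\<close>. A single power over the full interval gives a Beta function
(\<open>set_integral_Beta_scaled\<close>); the quotients of Gamma values at arguments that move by
\<open>2k\<close> split into Pochhammer symbols by the duplication formula, and the sum over \<open>k\<close>
collapses to one hypergeometric function of \<open>x\<^sup>2 / 4\<close>
(\<open>full_integral_Bessel_I_series\<close>). A single power over the initial interval gives an
incomplete Beta function, which is a \<open>\<^sub>2F\<^sub>1\<close> at \<open>a / x\<close> by the binomial series
(\<open>set_integral_incomplete_Beta\<close>); here the sum over \<open>k\<close> remains
(\<open>initial_integral_Bessel_I_series\<close>).

Both exchanges of sum and integral, for the Bessel series and for the binomial series,
are instances of \<open>set_integral_times_bounded_series\<close>: an integrable weight carries all
the endpoint singularities, and the remaining series is dominated uniformly on the
interval by a convergent numerical series.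
\<close>

section \<open>Termwise integration against an integrable weight\<close>

text \<open>
The \<open>n\<close>-th integral of absolute values is at most \<open>B n\<close> times the integral of
\<open>\<bar>w\<bar>\<close>, so these integrals are summable and dominated convergence applies. The weight
itself may be unbounded on \<open>S\<close>.
\<close>
lemma set_integral_times_bounded_series:
  fixes w :: "'a \<Rightarrow> real" and h :: "nat \<Rightarrow> 'a \<Rightarrow> real"
  assumes w: "set_integrable M S w" and S: "S \<in> sets M"
    and h: "\<And>n. h n \<in> borel_measurable M"
    and bound: "\<And>n t. t \<in> S \<Longrightarrow> \<bar>h n t\<bar> \<le> B n" and B: "summable B"
  shows "set_integrable M S (\<lambda>t. w t * (\<Sum>n. h n t))"
    and "(\<lambda>n. LINT t:S|M. w t * h n t) sums (LINT t:S|M. w t * (\<Sum>n. h n t))"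
proof -
  let ?w = "\<lambda>t. indicator S t * w t"
  let ?f = "\<lambda>n t. ?w t * h n t"
  have w': "integrable M ?w"
    using w by (simp add: set_integrable_def)
  have dom: "norm (?f n t) \<le> \<bar>?w t\<bar> * B n" for n t
    using bound[of t n] by (cases "t \<in> S") (auto simp: abs_mult intro!: mult_left_mono)
  have int: "integrable M (?f n)" for n
  proof (rule Bochner_Integration.integrable_bound)
    show "integrable M (\<lambda>t. \<bar>?w t\<bar> * B n)"
      using w' by simp
    show "?f n \<in> borel_measurable M"
      using borel_measurable_times[OF borel_measurable_integrable[OF w'] h] .
    show "AE t in M. norm (?f n t) \<le> norm (\<bar>?w t\<bar> * B n)"
      using order_trans[OF dom] by (intro always_eventually allI) (metis abs_ge_self real_norm_def)
  qed
  have pointwise: "AE t in M. summable (\<lambda>n. norm (?f n t))"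
    using dom by (intro always_eventually allI summable_comparison_test'[OF summable_mult[OF B], of 0]) auto
  have norms: "summable (\<lambda>n. LINT t|M. norm (?f n t))"
  proof (rule summable_comparison_test'[OF summable_mult[OF B], of 0])
    fix n :: nat
    have "(LINT t|M. norm (?f n t)) \<le> (LINT t|M. \<bar>?w t\<bar> * B n)"
      using int w' dom by (intro integral_mono) auto
    then show "norm (LINT t|M. norm (?f n t)) \<le> (LINT t|M. \<bar>?w t\<bar>) * B n"
      by simp
  qed
  have eq: "(\<Sum>n. ?f n t) = indicator S t * (w t * (\<Sum>n. h n t))" for t
  proof (cases "t \<in> S")
    case True
    then have "summable (\<lambda>n. h n t)"
      using bound by (intro summable_comparison_test'[OF B, of 0]) auto
    then show ?thesis
      by (simp add: suminf_mult mult.assoc)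
  qed simp
  show "set_integrable M S (\<lambda>t. w t * (\<Sum>n. h n t))"
    using integrable_suminf[OF int pointwise norms] by (simp add: set_integrable_def eq)
  show "(\<lambda>n. LINT t:S|M. w t * h n t) sums (LINT t:S|M. w t * (\<Sum>n. h n t))"
    using sums_integral[OF int pointwise norms]
    by (simp add: set_lebesgue_integral_def eq[simplified mult.assoc] mult.assoc)
qed

text \<open>
If \<open>c \<noteq> 0\<close>, then \<open>f\<close> converges along with the product; if \<open>c = 0\<close>, both sides vanish
whatever \<open>f\<close> does. The factors \<open>c\<close> below contain \<open>a powr p\<close>, which is \<open>0\<close> for \<open>a = 0\<close>.
\<close>
lemma sums_cmult_eq_cmult_suminf:
  fixes c s :: real
  assumes "(\<lambda>n. c * f n) sums s"
  shows "s = c * suminf f"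
proof (cases "c = 0")
  case True
  then show ?thesis
    using sums_unique[OF assms] by simp
next
  case False
  then show ?thesis
    using sums_unique[OF sums_mult_D[OF assms False]] by (simp add: field_simps)
qed

section \<open>Complete and incomplete Beta integrals\<close>

text \<open>
The substitution \<open>t = x s\<close> reduces this to Euler's Beta integral over \<open>[0, 1]\<close>.
\<close>
lemma set_integral_Beta_scaled:
  fixes \<alpha> p x :: real
  assumes "0 < \<alpha>" "0 < p" "0 < x"
  shows "set_integrable lborel {0..x} (\<lambda>t. (x - t) powr (\<alpha> - 1) * t powr (p - 1))"
    and "(LINT t:{0..x}|lborel. (x - t) powr (\<alpha> - 1) * t powr (p - 1)) =
           Gamma \<alpha> * Gamma p / Gamma (\<alpha> + p) * x powr (\<alpha> + p - 1)"
proof -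
  let ?f = "\<lambda>t. indicator {0..x} t *\<^sub>R ((x - t) powr (\<alpha> - 1) * t powr (p - 1))"
  let ?b = "\<lambda>t. indicator {0..1} t *\<^sub>R (t powr (p - 1) * (1 - t) powr (\<alpha> - 1))"
  have int: "integrable lborel ?b"
    using integrable_Beta[of p \<alpha>] assms by (simp add: set_integrable_def)
  have "(LINT t:{0..1}|lborel. t powr (p - 1) * (1 - t) powr (\<alpha> - 1)) = Beta p \<alpha>"
    using set_borel_integral_eq_integral(2)[OF integrable_Beta[of p \<alpha>]]
      has_integral_Beta_real[of p \<alpha>] assms by (simp add: integral_unique)
  then have hb: "has_bochner_integral lborel ?b (Beta p \<alpha>)"
    using int by (simp add: has_bochner_integral_iff set_lebesgue_integral_def)
  \<comment> \<open>\<open>\<alpha> + p - 2\<close>, because the Jacobian of the substitution contributes the last factor \<open>x\<close>\<close>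
  have pt: "?f (0 + x * s) = x powr (\<alpha> + p - 2) * ?b s" for s
  proof (cases "s \<in> {0..1}")
    case True
    have "x - x * s = x * (1 - s)"
      by (simp add: algebra_simps)
    moreover have "x powr (\<alpha> - 1) * x powr (p - 1) = x powr (\<alpha> + p - 2)"
      by (simp flip: powr_add)
    ultimately show ?thesis
      using True assms by (simp add: powr_mult mult_left_le)
  next
    case False
    then show ?thesis
      using assms by (auto simp: indicator_def zero_le_mult_iff)
  qed
  have "has_bochner_integral lborel (\<lambda>s. ?f (0 + x * s))
      ((\<bar>x\<bar> *\<^sub>R (x powr (\<alpha> + p - 2) * Beta p \<alpha>)) /\<^sub>R \<bar>x\<bar>)"
    unfolding pt using has_bochner_integral_mult_right[OF hb, of "x powr (\<alpha> + p - 2)"] assms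
    by (simp flip: mult.assoc)
  then have "has_bochner_integral lborel ?f (\<bar>x\<bar> *\<^sub>R (x powr (\<alpha> + p - 2) * Beta p \<alpha>))"
    using assms by (subst lborel_has_bochner_integral_real_affine_iff[of x _ _ 0]) simp_all
  moreover have "\<bar>x\<bar> *\<^sub>R (x powr (\<alpha> + p - 2) * Beta p \<alpha>) =
      Gamma \<alpha> * Gamma p / Gamma (\<alpha> + p) * x powr (\<alpha> + p - 1)"
  proof -
    have "x * x powr (\<alpha> + p - 2) = x powr (\<alpha> + p - 1)"
      using assms powr_add[of x 1 "\<alpha> + p - 2"] by (simp add: algebra_simps)
    then show ?thesis
      using assms by (simp add: Beta_def add.commute[of p] flip: mult.assoc)
  qed
  ultimately show "set_integrable lborel {0..x} (\<lambda>t. (x - t) powr (\<alpha> - 1) * t powr (p - 1))"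
    "(LINT t:{0..x}|lborel. (x - t) powr (\<alpha> - 1) * t powr (p - 1)) =
           Gamma \<alpha> * Gamma p / Gamma (\<alpha> + p) * x powr (\<alpha> + p - 1)"
    by (simp_all add: has_bochner_integral_iff set_integrable_def set_lebesgue_integral_def)
qed

lemma set_integral_powr:
  fixes p u :: real
  assumes "0 < p" "0 \<le> u"
  shows "set_integrable lborel {0..u} (\<lambda>t. t powr (p - 1))"
    and "(LINT t:{0..u}|lborel. t powr (p - 1)) = u powr p / p"
proof -
  have hi: "((\<lambda>t. t powr (p - 1)) has_integral u powr p / p) {0..u}"
    using has_integral_powr_from_0[of "p - 1" u] assms by simp
  then have "set_integrable lebesgue {0..u} (\<lambda>t. t powr (p - 1))"
    by (intro nonnegative_absolutely_integrable_1) (auto simp: integrable_on_def)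
  then show int: "set_integrable lborel {0..u} (\<lambda>t. t powr (p - 1))"
    unfolding set_integrable_def by (subst (asm) integrable_completion) auto
  show "(LINT t:{0..u}|lborel. t powr (p - 1)) = u powr p / p"
    using set_borel_integral_eq_integral(2)[OF int] hi by (simp add: integral_unique)
qed

lemma binomial_series_pochhammer:
  fixes \<beta> z :: real
  assumes "\<bar>z\<bar> < 1"
  shows "(\<lambda>n. pochhammer \<beta> n / fact n * z ^ n) sums (1 - z) powr (- \<beta>)"
proof -
  have "((- \<beta>) gchoose n) * (- z) ^ n = pochhammer \<beta> n / fact n * z ^ n" for n
  proof -
    have "(- 1) ^ n * (- z) ^ n = z ^ n"
      by (simp flip: power_mult_distrib)
    then show ?thesis
      by (simp add: gbinomial_pochhammer)
  qed
  then show ?thesis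
    using gen_binomial_real[of "- z" "- \<beta>"] assms by simp
qed

text \<open>
Expand \<open>(x - t) powr (\<alpha> - 1) = x powr (\<alpha> - 1) * (1 - t / x) powr (\<alpha> - 1)\<close> by the
binomial series, which converges uniformly on \<open>[0, a]\<close> because \<open>a < x\<close>, and integrate
each power. The resulting factor \<open>1 / (p + n)\<close> is \<open>(p)\<^sub>n / (p (p + 1)\<^sub>n)\<close>, which is the
way in which \<open>p\<close> and \<open>p + 1\<close> become parameters of \<open>\<^sub>2F\<^sub>1\<close>.
\<close>
lemma set_integral_incomplete_Beta:
  fixes \<alpha> p a x :: real
  assumes "0 < p" "0 \<le> a" "a < x"
  shows "(LINT t:{0..a}|lborel. (x - t) powr (\<alpha> - 1) * t powr (p - 1)) =
           x powr (\<alpha> - 1) * a powr p / p * hypergeo_F [p, 1 - \<alpha>] [p + 1] (a / x)"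
proof -
  let ?c = "\<lambda>n. pochhammer (1 - \<alpha>) n / fact n"
  have x: "0 < x"
    using assms by simp
  have binomial: "(\<lambda>n. ?c n * (t / x) ^ n) sums (1 - t / x) powr (\<alpha> - 1)"
    if "t \<in> {0..a}" for t
  proof -
    have "\<bar>t / x\<bar> < 1"
      using that assms x by (simp add: abs_of_nonneg)
    from binomial_series_pochhammer[OF this, of "1 - \<alpha>"] show ?thesis
      by simp
  qed
  have abs_conv: "summable (\<lambda>n. \<bar>?c n\<bar> * (a / x) ^ n)"
  proof -
    \<comment> \<open>a point strictly between \<open>a / x\<close> and the radius of convergence\<close>
    define r where "r = (a / x + 1) / 2"
    have r: "a / x < r" "r < 1" "0 < r"
      using assms x by (auto simp: r_def field_simps add_nonneg_pos)
    have "summable (\<lambda>n. ?c n * r ^ n)"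
      using binomial_series_pochhammer[of r "1 - \<alpha>"] r by (simp add: sums_iff)
    from powser_insidea[OF this, of "a / x"] show ?thesis
      using r assms x by (simp add: abs_mult)
  qed
  have term_integral: "(LINT t:{0..a}|lborel. t powr (p - 1) * (?c n * (t / x) ^ n)) =
      a powr p / p * (pochhammer p n * pochhammer (1 - \<alpha>) n / pochhammer (p + 1) n * (a / x) ^ n / fact n)"
    for n
  proof -
    have "(LINT t:{0..a}|lborel. t powr (p - 1) * (?c n * (t / x) ^ n)) =
        (LINT t:{0..a}|lborel. ?c n / x ^ n * t powr (p + n - 1))"
    proof (rule set_lebesgue_integral_cong)
      show "\<forall>t. t \<in> {0..a} \<longrightarrow> t powr (p - 1) * (?c n * (t / x) ^ n) =
          ?c n / x ^ n * t powr (p + n - 1)"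
      proof (intro allI impI)
        fix t :: real
        assume "t \<in> {0..a}"
        then have "t powr (p - 1) * t ^ n = t powr (p + n - 1)"
          using powr_add[of t "p - 1" n]
          by (cases "t = 0") (simp_all add: powr_realpow add_diff_eq diff_add_eq)
        then show "t powr (p - 1) * (?c n * (t / x) ^ n) = ?c n / x ^ n * t powr (p + n - 1)"
          by (simp add: power_divide)
      qed
    qed simp
    also have "\<dots> = ?c n / x ^ n * (a powr (p + n) / (p + n))"
      using set_integral_powr(2)[of "p + n" a] assms by simp
    also have "a powr (p + n) = a powr p * a ^ n"
      using assms by (cases "a = 0") (auto simp: powr_add powr_realpow)
    also have "1 / (p + n) = pochhammer p n / (p * pochhammer (p + 1) n)"
    proof -
      have "p * pochhammer (p + 1) n = pochhammer p n * (p + n)"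
        using pochhammer_rec[of p n] pochhammer_rec'[of p n] by (simp add: mult.commute)
      moreover have "pochhammer p n > 0"
        using assms by (simp add: pochhammer_pos)
      ultimately show ?thesis
        by simp
    qed
    then have "?c n / x ^ n * (a powr p * a ^ n / (p + n)) =
        ?c n / x ^ n * (a powr p * a ^ n * (pochhammer p n / (p * pochhammer (p + 1) n)))"
      by (metis divide_inverse inverse_eq_divide)
    also have "\<dots> = a powr p / p *
        (pochhammer p n * pochhammer (1 - \<alpha>) n / pochhammer (p + 1) n * (a / x) ^ n / fact n)"
      by (simp add: power_divide mult_ac)
    finally show ?thesis .
  qed
  have "(\<lambda>n. LINT t:{0..a}|lborel. t powr (p - 1) * (?c n * (t / x) ^ n)) sums
      (LINT t:{0..a}|lborel. t powr (p - 1) * (\<Sum>n. ?c n * (t / x) ^ n))"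
  proof (rule set_integral_times_bounded_series(2)[OF _ _ _ _ abs_conv])
    show "\<bar>?c n * (t / x) ^ n\<bar> \<le> \<bar>?c n\<bar> * (a / x) ^ n" if "t \<in> {0..a}" for n t
      using that x by (auto simp: abs_mult power_abs intro!: mult_left_mono power_mono divide_right_mono)
  qed (use assms in \<open>auto simp: set_integral_powr\<close>)
  moreover have "(LINT t:{0..a}|lborel. t powr (p - 1) * (\<Sum>n. ?c n * (t / x) ^ n)) =
      (LINT t:{0..a}|lborel. x powr (1 - \<alpha>) * ((x - t) powr (\<alpha> - 1) * t powr (p - 1)))"
  proof (rule set_lebesgue_integral_cong)
    show "\<forall>t. t \<in> {0..a} \<longrightarrow> t powr (p - 1) * (\<Sum>n. ?c n * (t / x) ^ n) =
        x powr (1 - \<alpha>) * ((x - t) powr (\<alpha> - 1) * t powr (p - 1))"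
    proof (intro allI impI)
      fix t
      assume t: "t \<in> {0..a}"
      have "1 - t / x = (x - t) / x"
        using x by (simp add: field_simps)
      then have "(1 - t / x) powr (\<alpha> - 1) = (x - t) powr (\<alpha> - 1) * x powr (1 - \<alpha>)"
        using t assms powr_minus[of x "\<alpha> - 1"] by (simp add: powr_divide inverse_eq_divide)
      then show "t powr (p - 1) * (\<Sum>n. ?c n * (t / x) ^ n) =
        x powr (1 - \<alpha>) * ((x - t) powr (\<alpha> - 1) * t powr (p - 1))"
        using sums_unique[OF binomial[OF t]] by simp
    qed
  qed simp
  ultimately have "(\<lambda>n. a powr p / p * (pochhammer p n * pochhammer (1 - \<alpha>) n / pochhammer (p + 1) n *
      (a / x) ^ n / fact n)) sums
      (x powr (1 - \<alpha>) * (LINT t:{0..a}|lborel. (x - t) powr (\<alpha> - 1) * t powr (p - 1)))"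
    by (simp only: term_integral set_integral_mult_right)
  from sums_cmult_eq_cmult_suminf[OF this]
  have eq: "x powr (1 - \<alpha>) * (LINT t:{0..a}|lborel. (x - t) powr (\<alpha> - 1) * t powr (p - 1)) =
      a powr p / p * hypergeo_F [p, 1 - \<alpha>] [p + 1] (a / x)"
    by (simp add: hypergeo_F_altdef)
  have "x powr (\<alpha> - 1) * x powr (1 - \<alpha>) = 1"
    using x by (simp flip: powr_add)
  then show ?thesis
    using arg_cong[OF eq, of "\<lambda>y. x powr (\<alpha> - 1) * y"] by (simp flip: mult.assoc)
qed

section \<open>Gamma function and hypergeometric identities\<close>

lemma Gamma_add_of_nat:
  fixes z :: real
  assumes "z \<notin> \<int>\<^sub>\<le>\<^sub>0"
  shows "Gamma (z + of_nat n) = pochhammer z n * Gamma z"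
  using pochhammer_Gamma[OF assms, of n] assms by (simp add: Gamma_eq_zero_iff)

lemma Gamma_add_even:
  fixes z :: real
  assumes "0 < z"
  shows "Gamma (z + 2 * real k) = 4 ^ k * pochhammer (z / 2) k * pochhammer ((z + 1) / 2) k * Gamma z"
proof -
  have "z \<notin> \<int>\<^sub>\<le>\<^sub>0"
    using assms by auto
  then show ?thesis
    using Gamma_add_of_nat[of z "2 * k"] pochhammer_double[of "z / 2" k]
    by (simp add: power_mult add_divide_distrib)
qed

lemma hypergeo_F_cancel:
  fixes c z :: real
  assumes "c \<notin> \<int>\<^sub>\<le>\<^sub>0"
  shows "hypergeo_F (c # as) (c # bs) z = hypergeo_F as bs z"
proof -
  have "pochhammer c k \<noteq> 0" for k
    using assms pochhammer_eq_0_imp_nonpos_Int by blast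
  then show ?thesis
    by (simp add: hypergeo_F_altdef)
qed

lemma hypergeo_F_swap: "hypergeo_F (c # d # as) bs z = hypergeo_F (d # c # as) bs z"
  by (simp add: hypergeo_F_altdef mult.left_commute)

text \<open>
Legendre's duplication formula, transferred from the complex Gamma function.
\<close>
lemma Gamma_double_real:
  fixes z :: real
  assumes "0 < z"
  shows "Gamma z * Gamma (z + 1 / 2) = 2 powr (1 - 2 * z) * sqrt pi * Gamma (2 * z)"
proof -
  have "complex_of_real z \<notin> \<int>\<^sub>\<le>\<^sub>0" "complex_of_real z + 1 / 2 \<notin> \<int>\<^sub>\<le>\<^sub>0"
    using assms by (auto elim!: nonpos_Ints_cases simp: complex_eq_iff)
  from Gamma_legendre_duplication[OF this]
  have "complex_of_real (Gamma z * Gamma (z + 1 / 2)) =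
      complex_of_real (exp ((1 - 2 * z) * ln 2) * sqrt pi * Gamma (2 * z))"
    by (simp flip: Gamma_complex_of_real exp_of_real)
  then show ?thesis
    unfolding of_real_eq_iff by (simp add: powr_def)
qed

section \<open>Fractional integrals of the Bessel series\<close>

text \<open>
The entire factor of \<open>Bessel_I\<close>: splitting off the power \<open>(t / 2) powr \<mu>\<close> leaves a
series that is bounded on bounded intervals, also for \<open>\<mu> < 0\<close>.
\<close>
definition Bessel_I_series :: "real \<Rightarrow> real \<Rightarrow> real" where
  "Bessel_I_series \<mu> t = (\<Sum>k. rGamma (of_nat k + \<mu> + 1) * (t\<^sup>2 / 4) ^ k / fact k)"

text \<open>
By \<open>z * rGamma (z + 1) = rGamma z\<close>, the reciprocal Gamma factor does not increase in
absolute value as soon as \<open>z \<ge> 1\<close>, so from then on the factor \<open>y / (k + 1)\<close> alone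
makes the ratio test succeed.
\<close>
lemma summable_rGamma_shift_power:
  fixes \<mu> y :: real
  assumes "0 \<le> y"
  shows "summable (\<lambda>k. \<bar>rGamma (of_nat k + \<mu> + 1)\<bar> * y ^ k / fact k)"
proof -
  obtain N :: nat where N: "max (- \<mu>) (2 * y) \<le> N"
    using real_arch_simple by blast
  have nonneg: "0 \<le> \<bar>rGamma (real k + \<mu> + 1)\<bar> * y ^ k / fact k" for k
    using assms by simp
  show ?thesis
  proof (rule summable_ratio_test[where c = "1 / 2" and N = N])
    fix k assume k: "N \<le> k"
    let ?z = "real k + \<mu> + 1"
    have z: "1 \<le> ?z" and k2: "2 * y \<le> real (Suc k)"
      using N k by linarith+
    have "\<bar>rGamma (?z + 1)\<bar> \<le> \<bar>?z\<bar> * \<bar>rGamma (?z + 1)\<bar>"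
      using z mult_right_mono[of 1 "\<bar>?z\<bar>" "\<bar>rGamma (?z + 1)\<bar>"] by simp
    also have "\<dots> = \<bar>rGamma ?z\<bar>"
      by (simp only: rGamma_plus1 flip: abs_mult)
    finally have "\<bar>rGamma (?z + 1)\<bar> \<le> \<bar>rGamma ?z\<bar>" .
    moreover have "y / Suc k \<le> 1 / 2"
      using k2 by (simp add: field_simps)
    ultimately have "y / Suc k * (\<bar>rGamma (?z + 1)\<bar> * y ^ k / fact k) \<le>
        1 / 2 * (\<bar>rGamma ?z\<bar> * y ^ k / fact k)"
      using assms by (intro mult_mono divide_right_mono mult_right_mono) auto
    moreover have "\<bar>rGamma (real (Suc k) + \<mu> + 1)\<bar> * y ^ Suc k / fact (Suc k) =
        y / Suc k * (\<bar>rGamma (?z + 1)\<bar> * y ^ k / fact k)"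
      by (simp add: add_ac mult_ac)
    ultimately show "norm (\<bar>rGamma (real (Suc k) + \<mu> + 1)\<bar> * y ^ Suc k / fact (Suc k)) \<le>
        1 / 2 * norm (\<bar>rGamma ?z\<bar> * y ^ k / fact k)"
      using assms nonneg[of "Suc k"] nonneg[of k] by (simp only: real_norm_def abs_of_nonneg)
  qed simp
qed

lemma powr_add_even_power:
  fixes p t :: real
  assumes "0 < t"
  shows "t powr (p + 2 * real k - 1) = t powr (p - 1) * (t\<^sup>2) ^ k"
proof -
  have "p + 2 * real k - 1 = (p - 1) + real (2 * k)"
    by simp
  then show ?thesis
    using assms powr_realpow[of t "2 * k"] by (simp only: powr_add power_mult)
qed

text \<open>
This is used for \<open>u = x\<close>, where the weight may be singular at both endpoints, and for
\<open>u = a\<close>.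
\<close>
lemma weighted_integral_Bessel_I_series:
  fixes \<alpha> \<mu> p u x :: real
  assumes "0 < \<alpha>" "0 < p" "u \<le> x" "0 < x"
  shows "set_integrable lborel {0..u}
           (\<lambda>t. (x - t) powr (\<alpha> - 1) * t powr (p - 1) * Bessel_I_series \<mu> t)"
    and "(\<lambda>k. rGamma (real k + \<mu> + 1) / (4 ^ k * fact k) *
             (LINT t:{0..u}|lborel. (x - t) powr (\<alpha> - 1) * t powr (p + 2 * real k - 1))) sums
           (LINT t:{0..u}|lborel. (x - t) powr (\<alpha> - 1) * t powr (p - 1) * Bessel_I_series \<mu> t)"
proof -
  let ?w = "\<lambda>t. (x - t) powr (\<alpha> - 1) * t powr (p - 1)"
  let ?h = "\<lambda>k t. rGamma (real k + \<mu> + 1) * (t\<^sup>2 / 4) ^ k / fact k"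
  have w: "set_integrable lborel {0..u} ?w"
    using assms by (intro set_integrable_subset[OF set_integral_Beta_scaled(1)[of \<alpha> p x]]) auto
  have bound: "\<bar>?h k t\<bar> \<le> \<bar>rGamma (real k + \<mu> + 1)\<bar> * (x\<^sup>2 / 4) ^ k / fact k"
    if "t \<in> {0..u}" for k t
    using that assms
    by (auto simp: abs_mult power_abs intro!: mult_left_mono power_mono divide_right_mono)
  have B: "summable (\<lambda>k. \<bar>rGamma (real k + \<mu> + 1)\<bar> * (x\<^sup>2 / 4) ^ k / fact k)"
    by (rule summable_rGamma_shift_power) simp
  note series = set_integral_times_bounded_series[OF w _ _ bound B]
  show "set_integrable lborel {0..u} (\<lambda>t. ?w t * Bessel_I_series \<mu> t)"
    unfolding Bessel_I_series_def by (rule series(1)) auto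
  have "(LINT t:{0..u}|lborel. ?w t * ?h k t) =
      rGamma (real k + \<mu> + 1) / (4 ^ k * fact k) *
      (LINT t:{0..u}|lborel. (x - t) powr (\<alpha> - 1) * t powr (p + 2 * real k - 1))" for k
  proof -
    have "(LINT t:{0..u}|lborel. ?w t * ?h k t) =
      (LINT t:{0..u}|lborel. rGamma (real k + \<mu> + 1) / (4 ^ k * fact k) *
         ((x - t) powr (\<alpha> - 1) * t powr (p + 2 * real k - 1)))"
    proof (rule set_lebesgue_integral_cong)
      show "\<forall>t. t \<in> {0..u} \<longrightarrow> ?w t * ?h k t = rGamma (real k + \<mu> + 1) / (4 ^ k * fact k) *
         ((x - t) powr (\<alpha> - 1) * t powr (p + 2 * real k - 1))"
      proof (intro allI impI)
        fix t :: real
        assume "t \<in> {0..u}"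
        \<comment> \<open>holds at \<open>t = 0\<close> too, since \<open>0 powr q = 0\<close> for every \<open>q\<close>, including \<open>q = 0\<close>\<close>
        then have "t powr (p + 2 * real k - 1) = t powr (p - 1) * (t\<^sup>2) ^ k"
          by (cases "t = 0") (simp_all add: powr_add_even_power)
        then show "?w t * ?h k t = rGamma (real k + \<mu> + 1) / (4 ^ k * fact k) *
         ((x - t) powr (\<alpha> - 1) * t powr (p + 2 * real k - 1))"
          by (simp add: power_divide)
      qed
    qed simp
    then show ?thesis
      by simp
  qed
  moreover have "(\<lambda>k. LINT t:{0..u}|lborel. ?w t * ?h k t) sums
      (LINT t:{0..u}|lborel. ?w t * (\<Sum>k. ?h k t))"
    by (rule series(2)) auto
  ultimately show "(\<lambda>k. rGamma (real k + \<mu> + 1) / (4 ^ k * fact k) *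
             (LINT t:{0..u}|lborel. (x - t) powr (\<alpha> - 1) * t powr (p + 2 * real k - 1))) sums
           (LINT t:{0..u}|lborel. (x - t) powr (\<alpha> - 1) * t powr (p - 1) * Bessel_I_series \<mu> t)"
    unfolding Bessel_I_series_def by simp
qed

text \<open>
The \<open>k\<close>-th term is a Beta value with \<open>\<Gamma>(p + 2k)\<close> above and \<open>\<Gamma>(\<alpha> + p + 2k)\<close> below.
Each of the two contributes a pair of Pochhammer symbols by \<open>Gamma_add_even\<close>, and their
powers of \<open>4\<close> cancel; the \<open>4\<^sup>k\<close> left in the coefficient turns \<open>x\<^sup>2\<^sup>k\<close> into
\<open>(x\<^sup>2 / 4)\<^sup>k\<close>.
\<close>
lemma full_integral_Bessel_I_series:
  fixes \<alpha> \<mu> p x :: real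
  assumes "0 < \<alpha>" "0 < p" "0 < x" "\<mu> + 1 \<notin> \<int>\<^sub>\<le>\<^sub>0"
  shows "(LINT t:{0..x}|lborel. (x - t) powr (\<alpha> - 1) * t powr (p - 1) * Bessel_I_series \<mu> t) =
           Gamma \<alpha> * Gamma p / (Gamma (\<alpha> + p) * Gamma (\<mu> + 1)) * x powr (\<alpha> + p - 1) *
           hypergeo_F [p / 2, (p + 1) / 2] [\<mu> + 1, (\<alpha> + p) / 2, (\<alpha> + p + 1) / 2] (x\<^sup>2 / 4)"
proof -
  define C where "C = Gamma \<alpha> * Gamma p / (Gamma (\<alpha> + p) * Gamma (\<mu> + 1)) * x powr (\<alpha> + p - 1)"
  define h where "h = (\<lambda>k. pochhammer (p / 2) k * pochhammer ((p + 1) / 2) k /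
      (pochhammer (\<mu> + 1) k * (pochhammer ((\<alpha> + p) / 2) k * pochhammer ((\<alpha> + p + 1) / 2) k)) *
      (x\<^sup>2 / 4) ^ k / fact k)"
  have "rGamma (real k + \<mu> + 1) / (4 ^ k * fact k) *
      (LINT t:{0..x}|lborel. (x - t) powr (\<alpha> - 1) * t powr (p + 2 * real k - 1)) = C * h k" for k
  proof -
    have rG: "rGamma (real k + \<mu> + 1) = 1 / (pochhammer (\<mu> + 1) k * Gamma (\<mu> + 1))"
      using Gamma_add_of_nat[OF assms(4), of k] by (simp add: rGamma_inverse_Gamma add_ac inverse_eq_divide)
    have xp: "x powr (\<alpha> + (p + 2 * real k) - 1) = x powr (\<alpha> + p - 1) * (x\<^sup>2) ^ k"
      using powr_add_even_power[of x "\<alpha> + p" k] assms by (simp only: add.assoc)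
    have G1: "Gamma (\<alpha> + (p + 2 * real k)) =
       4 ^ k * pochhammer ((\<alpha> + p) / 2) k * pochhammer ((\<alpha> + p + 1) / 2) k * Gamma (\<alpha> + p)"
      using Gamma_add_even[of "\<alpha> + p" k] assms by (simp add: add.assoc)
    have G2: "Gamma (p + 2 * real k) =
       4 ^ k * pochhammer (p / 2) k * pochhammer ((p + 1) / 2) k * Gamma p"
      using Gamma_add_even[of p k] assms by simp
    have beta: "(LINT t:{0..x}|lborel. (x - t) powr (\<alpha> - 1) * t powr (p + 2 * real k - 1)) =
       Gamma \<alpha> * Gamma (p + 2 * real k) / Gamma (\<alpha> + (p + 2 * real k)) * x powr (\<alpha> + (p + 2 * real k) - 1)"
      using assms by (intro set_integral_Beta_scaled(2)) auto
    have algebra: "1 / (M * N) / (f * F) * (G * (f * A * B * P) / (f * C * D * Q) * (y * z)) =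
        G * P / (Q * N) * y * (A * B / (M * (C * D)) * (z / f) / F)"
      if "f \<noteq> 0" for f M N F G A B P C D Q y z :: real
      using that by (simp add: divide_simps)
    show ?thesis
      unfolding C_def h_def power_divide beta rG xp G1 G2 by (rule algebra) simp
  qed
  then have sums: "(\<lambda>k. C * h k) sums
      (LINT t:{0..x}|lborel. (x - t) powr (\<alpha> - 1) * t powr (p - 1) * Bessel_I_series \<mu> t)"
    using weighted_integral_Bessel_I_series(2)[of \<alpha> p x x \<mu>, OF assms(1,2) order_refl assms(3)]
    by (simp only:)
  have "hypergeo_F [p / 2, (p + 1) / 2] [\<mu> + 1, (\<alpha> + p) / 2, (\<alpha> + p + 1) / 2] (x\<^sup>2 / 4) = suminf h"
    unfolding h_def hypergeo_F_altdef list.map prod_list.Cons prod_list.Nil mult_1_right ..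
  then show ?thesis
    unfolding sums_cmult_eq_cmult_suminf[OF sums] C_def by simp
qed

lemma initial_integral_Bessel_I_series:
  fixes \<alpha> \<mu> p a x :: real
  defines "D \<equiv> \<lambda>k. a ^ (2 * k) *
      hypergeo_F [p + 2 * real k, 1 - \<alpha>] [p + 2 * real k + 1] (a / x) /
      ((p + 2 * real k) * Gamma (real k + \<mu> + 1) * 4 ^ k * fact k)"
  assumes params: "0 < \<alpha>" "0 < p" "0 \<le> a" "a < x"
  shows "summable D"
    and "(LINT t:{0..a}|lborel. (x - t) powr (\<alpha> - 1) * t powr (p - 1) * Bessel_I_series \<mu> t) =
           a powr p * x powr (\<alpha> - 1) * suminf D"
proof -
  let ?C = "a powr p * x powr (\<alpha> - 1)"
  have "rGamma (real k + \<mu> + 1) / (4 ^ k * fact k) *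
      (LINT t:{0..a}|lborel. (x - t) powr (\<alpha> - 1) * t powr (p + 2 * real k - 1)) = ?C * D k" for k
  proof -
    have "a powr (p + 2 * real k) = a powr p * a ^ (2 * k)"
      using params powr_realpow[of a "2 * k"] by (cases "a = 0") (auto simp: powr_add)
    then show ?thesis
      using set_integral_incomplete_Beta[of "p + 2 * real k" a x \<alpha>] params
      unfolding D_def rGamma_inverse_Gamma by (simp add: divide_inverse mult_ac)
  qed
  then have sums: "(\<lambda>k. ?C * D k) sums
      (LINT t:{0..a}|lborel. (x - t) powr (\<alpha> - 1) * t powr (p - 1) * Bessel_I_series \<mu> t)"
    using weighted_integral_Bessel_I_series(2)[of \<alpha> p a x \<mu>] params by simp
  show D: "summable D"
  proof (cases "a = 0")
    \<comment> \<open>here the integral vanishes and says nothing about \<open>D\<close>, but only the term \<open>k = 0\<close> survives\<close>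
    case True
    then show ?thesis
      by (intro summable_finite[of "{0}"]) (auto simp: D_def)
  next
    case False
    then have "?C \<noteq> 0"
      using params by simp
    then show ?thesis
      using sums summable_cmult_iff[of ?C D] by (simp add: sums_iff)
  qed
  show "(LINT t:{0..a}|lborel. (x - t) powr (\<alpha> - 1) * t powr (p - 1) * Bessel_I_series \<mu> t) =
           ?C * suminf D"
    by (rule sums_cmult_eq_cmult_suminf[OF sums])
qed

text \<open>
The exponents are written as \<open>p - 1\<close> with \<open>p = 1\<close> and \<open>p = 2 * \<nu> + 1\<close> to fit the
integrals above. In particular \<open>t powr (1 - 1)\<close> is the indicator of \<open>t \<noteq> 0\<close>, which
makes the identity true at \<open>t = 0\<close>, where \<open>t powr \<nu>\<close> vanishes by convention.
\<close>
lemma powr_times_Bessel_K: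
  fixes \<nu> t :: real
  assumes "\<nu> \<notin> \<int>" "0 \<le> t"
  shows "t powr \<nu> * Bessel_K \<nu> t = pi / (2 * sin (pi * \<nu>)) *
      (2 powr \<nu> * (t powr (1 - 1) * Bessel_I_series (- \<nu>) t)
       - 2 powr (- \<nu>) * (t powr (2 * \<nu> + 1 - 1) * Bessel_I_series \<nu> t))"
proof (cases "t = 0")
  case False
  then have t: "0 < t"
    using assms by simp
  have 1: "t powr \<nu> * (t / 2) powr (- \<nu>) = 2 powr \<nu>"
    using t by (simp add: powr_divide powr_minus field_simps)
  have 2: "t powr \<nu> * (t / 2) powr \<nu> = 2 powr (- \<nu>) * t powr (2 * \<nu>)"
    using t by (simp add: powr_divide powr_minus field_simps flip: powr_add)
  have I: "Bessel_I \<mu> t = (t / 2) powr \<mu> * Bessel_I_series \<mu> t" for \<mu>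
    by (simp add: Bessel_I_def Bessel_I_series_def)
  have "Bessel_K \<nu> t = pi / (2 * sin (pi * \<nu>)) * (Bessel_I (- \<nu>) t - Bessel_I \<nu> t)"
    using assms(1) by (simp add: Bessel_K_def)
  then have "t powr \<nu> * Bessel_K \<nu> t = pi / (2 * sin (pi * \<nu>)) *
      ((t powr \<nu> * (t / 2) powr (- \<nu>)) * Bessel_I_series (- \<nu>) t
       - (t powr \<nu> * (t / 2) powr \<nu>) * Bessel_I_series \<nu> t)"
    by (simp only: I right_diff_distrib mult_ac)
  then show ?thesis
    unfolding 1 2 using t by simp
qed simp

section \<open>The fractional integral of the modified Bessel function\<close>

theorem theorem16:
  fixes \<alpha> \<nu> a x :: real
  assumes "\<alpha> > 0" and "\<alpha> \<notin> \<int>"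
    and "\<nu> > 0" and "\<nu> \<notin> \<int>"
    and "0 \<le> a" and "a < x"
  shows "RL_integrable a \<alpha> (\<lambda>\<tau>. \<tau> powr \<nu> * Bessel_K \<nu> \<tau>) x \<and>
      summable (\<lambda>k. a ^ (2 * k) *
            hypergeo_F [2 * real k + 1, 1 - \<alpha>] [2 * real k + 2] (a / x) /
            ((2 * real k + 1) * Gamma (- \<nu> + real k + 1) * 4 ^ k * fact k)) \<and>
      summable (\<lambda>k. a ^ (2 * k) *
            hypergeo_F [2 * \<nu> + 2 * real k + 1, 1 - \<alpha>] [2 * \<nu> + 2 * real k + 2] (a / x) /
            (4 ^ k * fact k * (2 * \<nu> + 2 * real k + 1) * Gamma (\<nu> + real k + 1))) \<and>
      RL_integral a \<alpha> (\<lambda>\<tau>. \<tau> powr \<nu> * Bessel_K \<nu> \<tau>) x =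
      pi / (2 * sin (pi * \<nu>)) *
      (2 powr \<nu> * x powr \<alpha> / (Gamma (1 - \<nu>) * Gamma (1 + \<alpha>)) *
         hypergeo_F [1 / 2, 1] [1 - \<nu>, (\<alpha> + 1) / 2, (\<alpha> + 2) / 2] (x\<^sup>2 / 4)
       - 2 powr \<nu> * Gamma (\<nu> + 1 / 2) / (sqrt pi * Gamma (\<alpha> + 2 * \<nu> + 1)) *
         x powr (\<alpha> + 2 * \<nu>) *
         hypergeo_F [\<nu> + 1 / 2] [(\<alpha> + 2 * \<nu> + 1) / 2, \<alpha> / 2 + \<nu> + 1] (x\<^sup>2 / 4)
       - a * 2 powr \<nu> * x powr (\<alpha> - 1) / Gamma \<alpha> *
         (\<Sum>k. a ^ (2 * k) *
            hypergeo_F [2 * real k + 1, 1 - \<alpha>] [2 * real k + 2] (a / x) /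
            ((2 * real k + 1) * Gamma (- \<nu> + real k + 1) * 4 ^ k * fact k))
       + a powr (2 * \<nu> + 1) / (2 powr \<nu> * Gamma \<alpha>) * x powr (\<alpha> - 1) *
         (\<Sum>k. a ^ (2 * k) *
            hypergeo_F [2 * \<nu> + 2 * real k + 1, 1 - \<alpha>] [2 * \<nu> + 2 * real k + 2] (a / x) /
            (4 ^ k * fact k * (2 * \<nu> + 2 * real k + 1) * Gamma (\<nu> + real k + 1))))"
proof -
  let ?f = "\<lambda>\<tau>. \<tau> powr \<nu> * Bessel_K \<nu> \<tau>"
  let ?c = "pi / (2 * sin (pi * \<nu>))"
  define g where "g = (\<lambda>p \<mu> \<tau>. (x - \<tau>) powr (\<alpha> - 1) * \<tau> powr (p - 1) * Bessel_I_series \<mu> \<tau>)"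
  let ?q = "2 * \<nu> + 1"
  define I where "I = (\<lambda>p \<mu> u. LINT \<tau>:{0..u}|lborel. g p \<mu> \<tau>)"
  let ?D1 = "\<lambda>k. a ^ (2 * k) *
            hypergeo_F [2 * real k + 1, 1 - \<alpha>] [2 * real k + 2] (a / x) /
            ((2 * real k + 1) * Gamma (- \<nu> + real k + 1) * 4 ^ k * fact k)"
  let ?D2 = "\<lambda>k. a ^ (2 * k) *
            hypergeo_F [2 * \<nu> + 2 * real k + 1, 1 - \<alpha>] [2 * \<nu> + 2 * real k + 2] (a / x) /
            (4 ^ k * fact k * (2 * \<nu> + 2 * real k + 1) * Gamma (\<nu> + real k + 1))"
  have x: "0 < x" and q: "0 < ?q"
    using assms by auto
  have nonint: "- \<nu> + 1 \<notin> \<int>\<^sub>\<le>\<^sub>0" "\<nu> + 1 \<notin> \<int>\<^sub>\<le>\<^sub>0"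
  proof -
    have "- \<nu> + 1 \<notin> \<int>"
    proof
      assume "- \<nu> + 1 \<in> \<int>"
      from Ints_diff[OF Ints_1 this] show False
        using assms(4) by simp
    qed
    then show "- \<nu> + 1 \<notin> \<int>\<^sub>\<le>\<^sub>0"
      using nonpos_Ints_subset_Ints by blast
    show "\<nu> + 1 \<notin> \<int>\<^sub>\<le>\<^sub>0"
      using assms(3) by auto
  qed

  have integrand: "(x - \<tau>) powr (\<alpha> - 1) * ?f \<tau> =
      ?c * (2 powr \<nu> * g 1 (- \<nu>) \<tau> - 2 powr (- \<nu>) * g ?q \<nu> \<tau>)" if "0 \<le> \<tau>" for \<tau>
    unfolding powr_times_Bessel_K[OF assms(4) that] by (simp only: g_def right_diff_distrib mult_ac)
  have integrable_g: "set_integrable lborel {0..u} (g 1 (- \<nu>))" "set_integrable lborel {0..u} (g ?q \<nu>)"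
    if "u \<le> x" for u
    unfolding g_def using assms(1) q x that
    by (intro weighted_integral_Bessel_I_series(1); simp)+
  have integrable: "set_integrable lborel {0..u} (\<lambda>\<tau>. (x - \<tau>) powr (\<alpha> - 1) * ?f \<tau>)"
    and integral: "(LINT \<tau>:{0..u}|lborel. (x - \<tau>) powr (\<alpha> - 1) * ?f \<tau>) =
      ?c * (2 powr \<nu> * I 1 (- \<nu>) u - 2 powr (- \<nu>) * I ?q \<nu> u)" if "u \<le> x" for u
  proof -
    have "set_integrable lborel {0..u} (\<lambda>\<tau>. ?c * (2 powr \<nu> * g 1 (- \<nu>) \<tau> - 2 powr (- \<nu>) * g ?q \<nu> \<tau>))"
      using integrable_g[OF that] by (intro set_integrable_mult_right set_integral_diff) auto
    then show "set_integrable lborel {0..u} (\<lambda>\<tau>. (x - \<tau>) powr (\<alpha> - 1) * ?f \<tau>)"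
      by (rule set_integrable_cong[THEN iffD1, rotated -1]) (auto simp: integrand)
    have "(LINT \<tau>:{0..u}|lborel. (x - \<tau>) powr (\<alpha> - 1) * ?f \<tau>) =
      (LINT \<tau>:{0..u}|lborel. ?c * (2 powr \<nu> * g 1 (- \<nu>) \<tau> - 2 powr (- \<nu>) * g ?q \<nu> \<tau>))"
      by (rule set_lebesgue_integral_cong) (auto simp: integrand)
    also have "\<dots> = ?c * (2 powr \<nu> * I 1 (- \<nu>) u - 2 powr (- \<nu>) * I ?q \<nu> u)"
      using integrable_g[OF that]
      by (simp add: I_def set_integral_diff(2))
    finally show "(LINT \<tau>:{0..u}|lborel. (x - \<tau>) powr (\<alpha> - 1) * ?f \<tau>) =
      ?c * (2 powr \<nu> * I 1 (- \<nu>) u - 2 powr (- \<nu>) * I ?q \<nu> u)" .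
  qed

  have rl: "RL_integrable a \<alpha> ?f x"
    unfolding RL_integrable_def using assms(5)
    by (intro set_integrable_subset[OF integrable[of x]]) auto
  have sum1: "summable ?D1" and I1a: "I 1 (- \<nu>) a = a * x powr (\<alpha> - 1) * suminf ?D1"
    using initial_integral_Bessel_I_series[of \<alpha> 1 a x "- \<nu>"] assms(1,5,6)
    unfolding I_def g_def by (simp_all add: add_ac mult_ac del: diff_self)
  have sum2: "summable ?D2" and I2a: "I ?q \<nu> a = a powr ?q * x powr (\<alpha> - 1) * suminf ?D2"
    using initial_integral_Bessel_I_series[of \<alpha> ?q a x \<nu>] assms(1,5,6) q
    unfolding I_def g_def by (simp_all add: add_ac mult_ac)
  let ?F1 = "hypergeo_F [1 / 2, 1] [1 - \<nu>, (\<alpha> + 1) / 2, (\<alpha> + 2) / 2] (x\<^sup>2 / 4)"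
  let ?F2 = "hypergeo_F [\<nu> + 1 / 2] [(\<alpha> + 2 * \<nu> + 1) / 2, \<alpha> / 2 + \<nu> + 1] (x\<^sup>2 / 4)"
  define X1 where "X1 = x powr \<alpha> / (Gamma (1 - \<nu>) * Gamma (1 + \<alpha>)) * ?F1"
  define X2 where "X2 = Gamma (\<nu> + 1 / 2) / (sqrt pi * Gamma (\<alpha> + 2 * \<nu> + 1)) * x powr (\<alpha> + 2 * \<nu>) * ?F2"
  have I1x: "I 1 (- \<nu>) x = Gamma \<alpha> * X1"
    using full_integral_Bessel_I_series[of \<alpha> 1 x "- \<nu>"] assms(1) x nonint
    unfolding I_def g_def X1_def by (simp add: add_ac mult_ac del: diff_self)
  have I2x: "I ?q \<nu> x = Gamma \<alpha> * (2 powr (2 * \<nu>) * X2)"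
  proof -
    \<comment> \<open>the upper parameter \<open>(p + 1) / 2 = \<nu> + 1\<close> cancels the lower parameter \<open>\<mu> + 1\<close>,
        so that the \<open>\<^sub>2F\<^sub>3\<close> drops to a \<open>\<^sub>1F\<^sub>2\<close>\<close>
    have "?q / 2 = \<nu> + 1 / 2" "(?q + 1) / 2 = \<nu> + 1" "(\<alpha> + ?q) / 2 = (\<alpha> + 2 * \<nu> + 1) / 2"
      "(\<alpha> + ?q + 1) / 2 = \<alpha> / 2 + \<nu> + 1"
      by (simp_all add: field_simps)
    then have F: "hypergeo_F [?q / 2, (?q + 1) / 2] [\<nu> + 1, (\<alpha> + ?q) / 2, (\<alpha> + ?q + 1) / 2] (x\<^sup>2 / 4) = ?F2"
      by (simp only: hypergeo_F_swap[of "\<nu> + 1 / 2"] hypergeo_F_cancel[OF nonint(2)])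
    have "Gamma (\<nu> + 1) \<noteq> 0"
      using nonint by (simp add: Gamma_eq_zero_iff)
    moreover have "Gamma (\<nu> + 1 / 2) * Gamma (\<nu> + 1) = 2 powr (- (2 * \<nu>)) * sqrt pi * Gamma ?q"
      using Gamma_double_real[of "\<nu> + 1 / 2"] assms(3) by (simp add: add.assoc distrib_left)
    ultimately have dup: "Gamma ?q / Gamma (\<nu> + 1) = 2 powr (2 * \<nu>) * Gamma (\<nu> + 1 / 2) / sqrt pi"
      by (simp add: powr_minus field_simps)
    have "I ?q \<nu> x = Gamma \<alpha> * (Gamma ?q / Gamma (\<nu> + 1)) / Gamma (\<alpha> + ?q) * x powr (\<alpha> + ?q - 1) * ?F2"
      using full_integral_Bessel_I_series[of \<alpha> ?q x \<nu>] assms(1) q x nonint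
      unfolding F I_def g_def by simp
    then show ?thesis
      unfolding dup X2_def by (simp add: add.assoc mult_ac)
  qed
  have split: "RL_integral a \<alpha> ?f x = 1 / Gamma \<alpha> * (?c * (2 powr \<nu> * I 1 (- \<nu>) x - 2 powr (- \<nu>) * I ?q \<nu> x)
     - ?c * (2 powr \<nu> * I 1 (- \<nu>) a - 2 powr (- \<nu>) * I ?q \<nu> a))"
  proof -
    have "(LINT \<tau>:{0..a} \<union> {a..x}|lborel. (x - \<tau>) powr (\<alpha> - 1) * ?f \<tau>) =
        (LINT \<tau>:{0..a}|lborel. (x - \<tau>) powr (\<alpha> - 1) * ?f \<tau>) +
        (LINT \<tau>:{a..x}|lborel. (x - \<tau>) powr (\<alpha> - 1) * ?f \<tau>)"
    proof (rule set_integral_Un_AE)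
      show "AE \<tau> in lborel. \<not> (\<tau> \<in> {0..a} \<and> \<tau> \<in> {a..x})"
        using AE_lborel_singleton[of a] by eventually_elim auto
      show "set_integrable lborel {0..a} (\<lambda>\<tau>. (x - \<tau>) powr (\<alpha> - 1) * ?f \<tau>)"
        using assms by (intro integrable) auto
      show "set_integrable lborel {a..x} (\<lambda>\<tau>. (x - \<tau>) powr (\<alpha> - 1) * ?f \<tau>)"
        using assms(5) by (intro set_integrable_subset[OF integrable[of x]]) auto
    qed auto
    moreover have "{0..a} \<union> {a..x} = {0..x}"
      using assms by auto
    ultimately show ?thesis
      unfolding RL_integral_def using integral[of a] integral[of x] assms(6) by simp
  qed
  have G: "Gamma \<alpha> \<noteq> 0"
    using Gamma_real_pos[OF assms(1)] by linarith
  have P: "2 powr (2 * \<nu>) = 2 powr \<nu> * 2 powr \<nu>" "2 powr (- \<nu>) = 1 / 2 powr \<nu>"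
    by (simp_all add: powr_minus_divide flip: powr_add)
  have "RL_integral a \<alpha> ?f x = ?c * (2 powr \<nu> * X1 - 2 powr \<nu> * X2
      - a * 2 powr \<nu> * x powr (\<alpha> - 1) / Gamma \<alpha> * suminf ?D1
      + a powr ?q / (2 powr \<nu> * Gamma \<alpha>) * x powr (\<alpha> - 1) * suminf ?D2)"
  proof -
    have algebra: "1 / G * (c * (P * (G * X) - 1 / P * (G * (P * P * Y))) -
        c * (P * (a * z * S) - 1 / P * (b * z * T))) =
        c * (P * X - P * Y - a * P * z / G * S + b / (P * G) * z * T)"
      if "G \<noteq> 0" "P \<noteq> 0" for G P c X Y S T a b z :: real
      using that by (simp add: field_simps)
    show ?thesis
      unfolding split I1a I2a I1x I2x P by (rule algebra) (use G in auto)
  qed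
  with rl sum1 sum2 show ?thesis
    unfolding X1_def X2_def by (simp only: mult.assoc times_divide_eq_left times_divide_eq_right simp_thms)
qed

end
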